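(* Let $q>1$ and $\lambda\in\mathbb{R}$. The power series $$\left(\sum_{m=0}^\infty \frac{t^m}{m!}\prod_{j=1}^m\left(\frac{1}{q^j}-1\right)\right)\lambda$$ is convergent for every $t\in\mathbb{R}$.
   Context: The empty product (for $m=0$) equals $1$. The series is the one obtained by successive approximation for the Ambartsumian equation $y'(t)=-y(t)+\frac1q y\left(\frac tq\right)$, $y(0)=\lambda$. *)

theory Defs
  imports Complex_Main
begin

end

theory Submission
  imports Defs
begin

text \<open>For \<open>q > 1\<close> each \<open>1 / q ^ j\<close> lies in (0, 1], so the products
  never exceed 1 in modulus. Comparison with the exponential series then gives absolute convergence
  for every \<open>t\<close>, and the constant \<open>lam\<close> factors out of a convergent
  sum.\<close>

text \<open>Every factor \<open>1 / q ^ j - 1\<close> lies in \<open>[-1, 0]\<close>, so the series is dominated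
  termwise by the exponential series of \<open>\<bar>t\<bar>\<close>.\<close>

theorem theorem10:
  fixes q lam :: real
  assumes "q > 1"
  shows "\<forall>t::real.
    summable (\<lambda>m::nat. t ^ m / fact m * (\<Prod>j = 1..m. (1 / q ^ j - 1))) \<and>
    (\<lambda>m::nat. t ^ m / fact m * (\<Prod>j = 1..m. (1 / q ^ j - 1)) * lam) sums
      ((\<Sum>m::nat. t ^ m / fact m * (\<Prod>j = 1..m. (1 / q ^ j - 1))) * lam)"
proof
  fix t :: real
  let ?a = "\<lambda>m::nat. t ^ m / fact m * (\<Prod>j = 1..m. (1 / q ^ j - 1))"
  have factor: "\<bar>1 / q ^ j - 1\<bar> \<le> 1" for j :: nat
  proof -
    have "1 \<le> q ^ j"
      using assms by (intro one_le_power) simp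
    then have "0 < 1 / q ^ j" "1 / q ^ j \<le> 1"
      by (auto simp: divide_le_eq_1)
    then show ?thesis
      by linarith
  qed
  have "\<bar>\<Prod>j = 1..m. (1 / q ^ j - 1)\<bar> \<le> 1" for m :: nat
    \<comment> \<open>The factors are nonpositive, so \<open>prod_le_1\<close> can only be applied
      to their absolute values.\<close>
    unfolding abs_prod using factor by (intro prod_le_1) auto
  then have "norm (?a m) \<le> \<bar>t\<bar> ^ m / fact m" for m
    by (simp add: abs_mult power_abs divide_right_mono mult_left_le)
  moreover have "summable (\<lambda>m. \<bar>t\<bar> ^ m / fact m)"
    \<comment> \<open>\<open>summable_exp\<close> has its terms in the form
      \<open>inverse (fact n) * x ^ n\<close>.\<close>
    using summable_exp[of "\<bar>t\<bar>"] by (simp add: divide_inverse mult.commute)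
  ultimately have "summable ?a"
    by (blast intro: summable_comparison_test')
  then show "summable ?a \<and> (\<lambda>m. ?a m * lam) sums (suminf ?a * lam)"
    by (intro conjI sums_mult2 summable_sums)
qed

end
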